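(* Let $k\ge 1$ be an integer, $m=k-1$, and let $G:[0,1]\times[0,1]\to\mathbb{R}$ be $$G(t,s)=\frac{1}{(m!)^2}\int_{0}^{\min(s,t)}(t-\tau)^m(s-\tau)^m\,d\tau .$$ Define $$M(t,s)=\sqrt{G(t,s)\,G(1,1)}-\sqrt{G(t,1)\,G(s,1)},\qquad t,s\in[0,1].$$ Then $M$ takes its maximum over the square $[0,1]\times[0,1]$ on the diagonal: there exists $t_0\in[0,1]$ such that $$\max_{0\le s\le 1,\ 0\le t\le 1} M(t,s)=M(t_0,t_0).$$
   Context: The function $G$ is the Green function of the focal boundary value problem of even order $n=2k$: $(-1)^{n-k}x^{(n)}(t)=f(t)$ for $t\in[0,1]$, with $x^{(i)}(0)=0$ for $i=0,\dots,k-1$ and $x^{(j)}(1)=0$ for $j=k,\dots,n-1$. That is, for every integrable $f$ the unique solution is $x(t)=\int_0^1 G(t,s)f(s)\,ds$. The function $G$ is symmetric and nonnegative. Convention: $0^0=1$ (so for $m=0$ one has $G(t,s)=\min(t,s)$). *)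

theory Defs
  imports "HOL-Analysis.Analysis"
begin

text \<open>
  Green function on the unit square of the focal problem of order \<open>2k\<close>, \<open>k \<ge> 1\<close>:
  \<open>(-1)^k x^(2k) = f\<close>, with the derivatives of order \<open>0, \<dots>, k - 1\<close> vanishing at \<open>0\<close>
  and those of order \<open>k, \<dots>, 2k - 1\<close> vanishing at \<open>1\<close>.
  For \<open>k = 1\<close> the integrand is \<open>1\<close> (as \<open>0 ^ 0 = 1\<close>), so the value is \<open>min t s\<close>.
\<close>
definition focal_green :: "nat \<Rightarrow> real \<Rightarrow> real \<Rightarrow> real" where
  "focal_green k t s =
     (let m = k - 1
      in 1 / (fact m)\<^sup>2 * integral {0..min s t} (\<lambda>\<tau>. (t - \<tau>) ^ m * (s - \<tau>) ^ m))"

definition focal_M :: "nat \<Rightarrow> real \<Rightarrow> real \<Rightarrow> real" where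
  "focal_M k t s =
     sqrt (focal_green k t s * focal_green k 1 1) - sqrt (focal_green k t 1 * focal_green k s 1)"

end

theory Submission
  imports Defs
begin

text \<open>
  Write \<open>m = k - 1\<close>, \<open>n = 2m + 1\<close> and, for \<open>0 \<le> s \<le> t\<close>, let \<open>H(t,s)\<close> be \<open>(m!)\<^sup>2 G(t,s)\<close>; it is
  homogeneous of degree \<open>n\<close>. Put \<open>g(x) = H(1,x)\<close> and \<open>\<alpha>(x) = x g'(x) / g(x)\<close>. Since \<open>M\<close> vanishes
  when an argument is \<open>0\<close> or \<open>1\<close>, a maximum off the diagonal would be a critical point \<open>0 < s < t < 1\<close>.
  With \<open>r = s/t\<close> the logarithmic derivatives of \<open>H\<close> in \<open>s\<close> and \<open>t\<close> are \<open>\<alpha>(r)\<close> and \<open>n - \<alpha>(r)\<close>, so the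
  two critical point equations force \<open>\<alpha>(s) (n - \<alpha>(r)) = \<alpha>(r) \<alpha>(t)\<close>.
  This is impossible because \<open>\<alpha>(s) (n - \<alpha>(r)) < \<alpha>(r) \<alpha>(t)\<close>, which in terms of
  \<open>\<psi> = m + 1 - \<alpha>\<close> follows from \<open>0 \<le> \<psi>(t) - \<psi>(rt) < 1 - 2 \<psi>(r)\<close>.
  From \<open>(1 - x) g' = x\<^sup>m - n g\<close> one gets a Riccati equation for \<open>\<psi>\<close>; comparison arguments give
  \<open>x/2 \<le> \<psi>(x) \<le> x/(1 + x)\<close> and then \<open>0 \<le> \<psi>'(x) \<le> 2/(1 + x)\<^sup>2\<close> for \<open>m \<ge> 2\<close>, which suffices;
  for \<open>m = 1\<close>, where the lower bound on \<open>\<psi>\<close> fails, \<open>\<psi>(x) = x/(3 - x)\<close>.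
\<close>

section \<open>The Green function as a polynomial\<close>

text \<open>For \<open>s \<le> t\<close> this is H: \<open>(t - \<tau>) ^ m\<close> is expanded
  binomially in \<open>t - s\<close> and \<open>s - \<tau>\<close>, and the integral is taken term
  by term.\<close>

definition green_poly :: "nat \<Rightarrow> real \<Rightarrow> real \<Rightarrow> real" where
  "green_poly m t s =
     (\<Sum>i\<le>m. of_nat (m choose i) * (t - s) ^ i * s ^ Suc (2 * m - i) / of_nat (Suc (2 * m - i)))"

text \<open>Used in two ways: \<open>x = s - \<tau>\<close> recovers the integrand of the Green
  function, \<open>x = s\<close> gives \<open>t ^ m * s ^ m\<close>.\<close>

lemma sum_binomial_power_diff:
  fixes t s x :: real
  shows "(\<Sum>i\<le>m. of_nat (m choose i) * (t - s) ^ i * x ^ (2 * m - i)) = (t - s + x) ^ m * x ^ m"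
proof -
  have "(\<Sum>i\<le>m. of_nat (m choose i) * (t - s) ^ i * x ^ (2 * m - i))
      = (\<Sum>i\<le>m. of_nat (m choose i) * (t - s) ^ i * x ^ (m - i) * x ^ m)"
    by (intro sum.cong refl) (simp flip: power_add add: mult.assoc mult_2)
  then show ?thesis
    by (simp add: binomial_ring sum_distrib_right)
qed

lemma integral_eq_green_poly:
  assumes "0 \<le> s"
  shows "integral {0..s} (\<lambda>\<tau>. (t - \<tau>) ^ m * (s - \<tau>) ^ m) = green_poly m t s"
proof -
  \<comment> \<open>A termwise antiderivative in \<open>\<tau>\<close>. All its exponents are
    positive, so it vanishes at \<open>\<tau> = s\<close> and only the value at \<open>0\<close>
    survives.\<close>
  let ?F = "\<lambda>\<tau>. - (\<Sum>i\<le>m. of_nat (m choose i) * (t - s) ^ i * (s - \<tau>) ^ Suc (2 * m - i) / of_nat (Suc (2 * m - i)))"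
  have "((\<lambda>\<tau>. (t - \<tau>) ^ m * (s - \<tau>) ^ m) has_integral ?F s - ?F 0) {0..s}"
  proof (rule fundamental_theorem_of_calculus[OF assms])
    fix \<tau>
    have "(?F has_real_derivative
        - (\<Sum>i\<le>m. - (of_nat (m choose i) * (t - s) ^ i * (s - \<tau>) ^ (2 * m - i)))) (at \<tau>)"
      by (intro DERIV_minus DERIV_sum)
        (auto intro!: derivative_eq_intros simp del: of_nat_Suc power_Suc)
    then have "(?F has_real_derivative (t - \<tau>) ^ m * (s - \<tau>) ^ m) (at \<tau>)"
      using sum_binomial_power_diff[of m t s "s - \<tau>"] by (simp add: sum_negf)
    then show "(?F has_vector_derivative (t - \<tau>) ^ m * (s - \<tau>) ^ m) (at \<tau> within {0..s})"
      by (simp add: has_real_derivative_iff_has_vector_derivative has_vector_derivative_at_within)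
  qed
  moreover have "?F s = 0"
    by (auto intro!: sum.neutral)
  ultimately show ?thesis
    by (simp add: green_poly_def integral_unique)
qed

lemma green_poly_scale: "green_poly m (c * t) (c * s) = c ^ (2 * m + 1) * green_poly m t s"
  unfolding green_poly_def sum_distrib_left
proof (rule sum.cong[OF refl])
  fix i assume "i \<in> {..m}"
  then have c: "c ^ (2 * m + 1) = c ^ i * c ^ Suc (2 * m - i)"
    by (simp flip: power_add power_Suc)
  have "c * t - c * s = c * (t - s)"
    by (simp add: right_diff_distrib)
  then show "of_nat (m choose i) * (c * t - c * s) ^ i * (c * s) ^ Suc (2 * m - i) / of_nat (Suc (2 * m - i))
      = c ^ (2 * m + 1) * (of_nat (m choose i) * (t - s) ^ i * s ^ Suc (2 * m - i) / of_nat (Suc (2 * m - i)))"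
    unfolding c by (simp only: power_mult_distrib times_divide_eq_right) (simp only: mult_ac)
qed

lemma green_poly_pos:
  assumes "0 < s" "s \<le> t"
  shows "0 < green_poly m t s"
  unfolding green_poly_def
proof (rule sum_pos2)
  show "0 < of_nat (m choose 0) * (t - s) ^ 0 * s ^ Suc (2 * m - 0) / of_nat (Suc (2 * m - 0))"
    using assms by simp
qed (use assms in auto)

lemma green_poly_zero [simp]: "green_poly m t 0 = 0"
  by (auto simp: green_poly_def intro!: sum.neutral)

lemma continuous_green_poly [continuous_intros]:
  fixes f g :: "'a::topological_space \<Rightarrow> real"
  assumes "continuous_on S f" "continuous_on S g"
  shows "continuous_on S (\<lambda>x. green_poly m (f x) (g x))"
  unfolding green_poly_def by (intro continuous_intros assms) auto

text \<open>Both derivatives come from \<open>i / (2m + 1 - i) = (2m + 1) / (2m + 1 - i) - 1\<close>, i.e. from combining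
  Euler's identity \<open>t H\<^sub>t + s H\<^sub>s = (2m + 1) H\<close> with \<open>H\<^sub>t + H\<^sub>s = (t s)\<^sup>m\<close>.\<close>

lemma DERIV_green_poly_fst:
  assumes "s \<noteq> t"
  shows "((\<lambda>t. green_poly m t s) has_real_derivative
    (of_nat (2 * m + 1) * green_poly m t s - s ^ (m + 1) * t ^ m) / (t - s)) (at t)"
proof -
  let ?c = "\<lambda>i. of_nat (m choose i) * of_nat i * (t - s) ^ (i - 1) * s ^ Suc (2 * m - i) / of_nat (Suc (2 * m - i)) :: real"
  have "((\<lambda>t. green_poly m t s) has_real_derivative (\<Sum>i\<le>m. ?c i)) (at t)"
    unfolding green_poly_def
    by (intro DERIV_sum) (auto intro!: derivative_eq_intros simp del: of_nat_Suc power_Suc)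
  moreover have "(\<Sum>i\<le>m. ?c i) = (of_nat (2 * m + 1) * green_poly m t s - s ^ (m + 1) * t ^ m) / (t - s)"
  proof -
    have "(t - s) * ?c i = of_nat (2 * m + 1) * (of_nat (m choose i) * (t - s) ^ i * s ^ Suc (2 * m - i) / of_nat (Suc (2 * m - i)))
        - s * (of_nat (m choose i) * (t - s) ^ i * s ^ (2 * m - i))" if "i \<le> m" for i
    proof -
      define d where "d = (of_nat (Suc (2 * m - i)) :: real)"
      have d: "d > 0" "of_nat i = of_nat (2 * m + 1) - d"
        using that by (simp_all add: d_def of_nat_diff)
      \<comment> \<open>The factor \<open>of_nat i\<close> takes care of \<open>i = 0\<close>, where
        \<open>i - 1\<close> truncates to \<open>0\<close>.\<close>
      have q: "of_nat i * ((t - s) ^ (i - 1) * (t - s)) = of_nat i * (t - s) ^ i"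
        by (cases i) auto
      have "(t - s) * ?c i = of_nat (m choose i) * (of_nat i * ((t - s) ^ (i - 1) * (t - s))) * s ^ Suc (2 * m - i) / d"
        by (simp add: d_def)
      also have "\<dots> = of_nat (m choose i) * ((of_nat (2 * m + 1) - d) * (t - s) ^ i) * s ^ Suc (2 * m - i) / d"
        by (simp only: q flip: d(2))
      also have "\<dots> = of_nat (2 * m + 1) * (of_nat (m choose i) * (t - s) ^ i * s ^ Suc (2 * m - i) / d)
        - s * (of_nat (m choose i) * (t - s) ^ i * s ^ (2 * m - i))"
        using d(1) by (simp add: field_simps)
      finally show ?thesis
        unfolding d_def .
    qed
    then have "(t - s) * (\<Sum>i\<le>m. ?c i) = of_nat (2 * m + 1) * green_poly m t s
        - s * (\<Sum>i\<le>m. of_nat (m choose i) * (t - s) ^ i * s ^ (2 * m - i))"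
      by (simp only: sum_distrib_left green_poly_def flip: sum_subtractf) (intro sum.cong refl, simp)
    then have "(\<Sum>i\<le>m. ?c i) * (t - s) = of_nat (2 * m + 1) * green_poly m t s - s ^ (m + 1) * t ^ m"
      unfolding sum_binomial_power_diff by (simp only: mult.commute mult.left_commute power_add power_one_right) simp
    then show ?thesis
      using assms by (subst nonzero_eq_divide_eq) simp_all
  qed
  ultimately show ?thesis
    by (simp only:)
qed

lemma DERIV_green_poly_snd:
  assumes "s \<noteq> t"
  shows "((\<lambda>s. green_poly m t s) has_real_derivative
    (t ^ (m + 1) * s ^ m - of_nat (2 * m + 1) * green_poly m t s) / (t - s)) (at s)"
proof -
  let ?c = "\<lambda>i. of_nat (m choose i) * of_nat i * (t - s) ^ (i - 1) * s ^ Suc (2 * m - i) / of_nat (Suc (2 * m - i)) :: real"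
  let ?e = "\<lambda>i. of_nat (m choose i) * (t - s) ^ i * s ^ (2 * m - i) :: real"
  have "((\<lambda>t. green_poly m t s) has_real_derivative (\<Sum>i\<le>m. ?c i)) (at t)"
    unfolding green_poly_def
    by (intro DERIV_sum) (auto intro!: derivative_eq_intros simp del: of_nat_Suc power_Suc)
  \<comment> \<open>The \<open>?c i\<close> sum to the derivative in \<open>t\<close>, so uniqueness
    of derivatives evaluates the sum. The product rule in \<open>s\<close> produces it again with
    the opposite sign.\<close>
  then have *: "(\<Sum>i\<le>m. ?c i) = (of_nat (2 * m + 1) * green_poly m t s - s ^ (m + 1) * t ^ m) / (t - s)"
    using DERIV_green_poly_fst[OF assms] DERIV_unique by blast
  have "((\<lambda>s. green_poly m t s) has_real_derivative (\<Sum>i\<le>m. ?e i - ?c i)) (at s)"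
    unfolding green_poly_def
    by (intro DERIV_sum)
      (auto intro!: derivative_eq_intros simp del: of_nat_Suc power_Suc simp: diff_divide_distrib)
  also have "(\<Sum>i\<le>m. ?e i - ?c i) = t ^ m * s ^ m
      - (of_nat (2 * m + 1) * green_poly m t s - s ^ (m + 1) * t ^ m) / (t - s)"
    using sum_binomial_power_diff[of m t s s] * by (simp add: sum_subtractf)
  also have "\<dots> = (t ^ (m + 1) * s ^ m - of_nat (2 * m + 1) * green_poly m t s) / (t - s)"
    using assms by (simp add: field_simps)
  finally show ?thesis .
qed

section \<open>Comparison arguments\<close>

text \<open>Wherever \<open>f\<close> is negative it does not decrease. To the left of a point with
  a negative value, \<open>f\<close> therefore never exceeds that value, so its limit at
  \<open>0\<close> would be negative too.\<close>

lemma nonneg_barrier: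
  fixes f f' :: "real \<Rightarrow> real"
  assumes deriv: "\<And>x. 0 < x \<Longrightarrow> x < 1 \<Longrightarrow> (f has_real_derivative f' x) (at x)"
    and sign: "\<And>x. 0 < x \<Longrightarrow> x < 1 \<Longrightarrow> f x < 0 \<Longrightarrow> 0 \<le> f' x"
    and lim: "(f \<longlongrightarrow> 0) (at_right 0)"
    and x: "0 < x" "x < 1"
  shows "0 \<le> f x"
proof (rule ccontr)
  assume neg: "\<not> 0 \<le> f x"
  have "isCont f z" if "z \<in> {0<..<1}" for z
    by (rule DERIV_isCont[OF deriv]) (use that in auto)
  then have cont: "continuous_on {0<..<1} f"
    by (intro continuous_at_imp_continuous_on) blast
  have below: "f y \<le> f x" if y: "0 < y" "y < x" for y
  proof (rule ccontr)
    assume gt: "\<not> f y \<le> f x"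
    \<comment> \<open>A negative level above \<open>f x\<close> and at most \<open>f y\<close>.
      After its last crossing \<open>w\<close> the function stays negative up to \<open>x\<close>,
      hence does not decrease, against \<open>f x < c = f w\<close>.\<close>
    define c where "c = min (f y) (f x / 2)"
    have c: "f x < c" "c \<le> f y" "c < 0"
      using neg gt by (auto simp: c_def)
    have conty: "continuous_on {y..x} f"
      by (rule continuous_on_subset[OF cont]) (use x y in auto)
    have cl: "closed {z \<in> {y..x}. f z = c}"
    proof -
      have "closed ({y..x} \<inter> f -` {c})"
        by (rule continuous_closed_preimage[OF conty]) auto
      moreover have "{z \<in> {y..x}. f z = c} = {y..x} \<inter> f -` {c}" by auto
      ultimately show ?thesis by simp
    qed
    let ?S = "{z \<in> {y..x}. f z = c}"
    have "\<exists>z\<ge>y. z \<le> x \<and> f z = c"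
      by (rule IVT2') (use c y conty in auto)
    then have ne: "?S \<noteq> {}" by auto
    have "compact ?S"
      using cl by (simp add: compact_eq_bounded_closed) (rule bounded_subset[of "{y..x}"], auto)
    from compact_attains_sup[OF this ne] obtain w where w: "w \<in> ?S" "\<forall>z\<in>?S. z \<le> w"
      by blast
    have wx: "y \<le> w" "w < x" "f w = c"
      using w c by (auto simp: less_le)
    have neg': "f z < 0" if "w \<le> z" "z \<le> x" for z
    proof (rule ccontr)
      assume "\<not> f z < 0"
      then have "\<exists>v\<ge>z. v \<le> x \<and> f v = c"
        using that c wx by (intro IVT2') (auto intro: continuous_on_subset[OF conty])
      then obtain v where "z \<le> v" "v \<le> x" "f v = c" by auto
      then have "v \<le> w"
        using w wx that by auto
      then have "z = w"
        using \<open>z \<le> v\<close> that by auto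
      then show False
        using \<open>\<not> f z < 0\<close> c wx by auto
    qed
    have "f w \<le> f x"
    proof (rule DERIV_nonneg_imp_nondecreasing[where f = f])
      show "w \<le> x" using wx by simp
      fix z assume z: "w \<le> z" "z \<le> x"
      then have "0 < z" "z < 1" using wx x y by auto
      then show "\<exists>d. (f has_real_derivative d) (at z) \<and> 0 \<le> d"
        using deriv sign neg'[OF z] by blast
    qed
    then show False using wx c by simp
  qed
  have "eventually (\<lambda>y. f y \<le> f x) (at_right 0)"
    unfolding eventually_at_right_field using x below by blast
  then have "0 \<le> f x"
    using tendsto_upperbound[OF lim] by (simp add: trivial_limit_at_right_real)
  then show False using neg by simp
qed

text \<open>\<open>h x = x p'(x)\<close> itself satisfies a first-order equation, linear in \<open>h\<close> with a nonpositive coefficient,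
  so that both bounds are barriers for it.\<close>

lemma riccati_bounds:
  fixes p :: "real \<Rightarrow> real" and m :: real
  defines "h \<equiv> \<lambda>x. (x * (1 - p x) * (m + p x) - p x * (m + 1 - p x)) / (1 - x)"
  assumes m: "2 \<le> m"
    and deriv: "\<And>x. 0 < x \<Longrightarrow> x < 1 \<Longrightarrow> (p has_real_derivative h x / x) (at x)"
    and lower: "\<And>x. 0 < x \<Longrightarrow> x < 1 \<Longrightarrow> x / 2 \<le> p x"
    and upper: "\<And>x. 0 < x \<Longrightarrow> x < 1 \<Longrightarrow> p x \<le> x / (1 + x)"
    and x: "0 < x" "x < 1"
  shows "0 \<le> h x" "h x \<le> 2 * x / (1 + x)\<^sup>2"
proof -
  \<comment> \<open>Differentiating \<open>(1 - x) * h x\<close> and replacing the derivative of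
    \<open>p\<close> by \<open>h x / x\<close> gives
    \<open>x (1 - x) h' = x (1 - p) (m + p) - C h\<close>; \<open>E\<close> is this equation solved
    for \<open>h'\<close>.\<close>
  define C where "C = (\<lambda>x. m + 1 + (m - 2) * x - 2 * p x * (1 - x))"
  define E where "E = (\<lambda>x. (x * ((1 - p x) * (m + p x)) - h x * C x) / (x * (1 - x)))"
  have half: "0 \<le> p y" "p y \<le> 1 / 2" "p y \<le> y" if "0 < y" "y < 1" for y
  proof -
    have "y / (1 + y) \<le> 1 / 2" "y / (1 + y) \<le> y"
      using that by (auto simp: divide_simps)
    then show "0 \<le> p y" "p y \<le> 1 / 2" "p y \<le> y"
      using lower[OF that] upper[OF that] that by linarith+
  qed
  have C: "0 \<le> C y" if y: "0 < y" "y < 1" for y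
  proof -
    have "2 * p y * (1 - y) \<le> 1 * 1"
      using half[OF y] y by (intro mult_mono) auto
    moreover have "0 \<le> (m - 2) * y"
      using m y by simp
    ultimately show ?thesis
      using m by (simp add: C_def)
  qed
  have dchi: "(h has_real_derivative E y) (at y)" if y: "0 < y" "y < 1" for y
  proof -
    define c where "c = h y"
    have c: "y * (1 - p y) * (m + p y) - p y * (m + 1 - p y) = c * (1 - y)"
      using y by (simp add: c_def h_def)
    have dp: "(p has_real_derivative c / y) (at y)"
      using deriv[OF y] by (simp add: c_def)
    have "((\<lambda>x. x * (1 - p x) * (m + p x) - p x * (m + 1 - p x)) has_real_derivative
      (1 - p y) * (m + p y) + (y * (1 - m - 2 * p y) - (m + 1 - 2 * p y)) * D) (at y)"
      if "(p has_real_derivative D) (at y)" for D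
      by (rule derivative_eq_intros that refl)+ (simp add: algebra_simps)
    note dn = this[OF dp]
    have "(h has_real_derivative
      (((1 - p y) * (m + p y) + (y * (1 - m - 2 * p y) - (m + 1 - 2 * p y)) * (c / y)) * (1 - y)
        + c * (1 - y)) / (1 - y)\<^sup>2) (at y)"
      using DERIV_divide[OF dn DERIV_diff[OF DERIV_const DERIV_ident], of 1] y
      unfolding h_def c by (simp add: power2_eq_square)
    moreover have "(((1 - p y) * (m + p y) + (y * (1 - m - 2 * p y) - (m + 1 - 2 * p y)) * (c / y)) * (1 - y)
        + c * (1 - y)) / (1 - y)\<^sup>2 = E y"
      using y unfolding E_def C_def c_def[symmetric] by (simp add: divide_simps) algebra
    ultimately show ?thesis
      by simp
  qed
  have "(p \<longlongrightarrow> 0) (at_right 0)"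
  proof (rule tendsto_sandwich)
    show "\<forall>\<^sub>F y in at_right 0. 0 \<le> p y" "\<forall>\<^sub>F y in at_right 0. p y \<le> y"
      unfolding eventually_at_right_field by (use half zero_less_one in blast)+
  qed (auto intro!: tendsto_eq_intros)
  then have lim: "(h \<longlongrightarrow> 0) (at_right 0)"
    unfolding h_def by (auto intro!: tendsto_eq_intros)
  show "0 \<le> h x"
  proof (rule nonneg_barrier[OF dchi _ lim x])
    fix y assume y: "0 < y" "y < 1" "h y < 0"
    have "0 \<le> y * ((1 - p y) * (m + p y))"
      using half[OF y(1,2)] y m by simp
    moreover have "h y * C y \<le> 0"
      using C[OF y(1,2)] y(3) by (simp add: mult_nonpos_nonneg)
    ultimately show "0 \<le> E y"
      using y by (simp add: E_def)
  qed
  \<comment> \<open>The bound is itself increasing on the interval, so it is enough that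
    \<open>E y \<le> 0\<close> wherever \<open>h\<close> lies above it.\<close>
  have "0 \<le> 2 * x / (1 + x)\<^sup>2 - h x"
  proof (rule nonneg_barrier[OF _ _ _ x])
    fix y :: real assume y: "0 < y" "y < 1"
    have "((\<lambda>x. 2 * x / (1 + x)\<^sup>2) has_real_derivative
        (2 * (1 + y)\<^sup>2 - 2 * y * (2 * (1 + y))) / ((1 + y)\<^sup>2 * (1 + y)\<^sup>2)) (at y)"
      using y by (auto intro!: derivative_eq_intros)
    also have "(2 * (1 + y)\<^sup>2 - 2 * y * (2 * (1 + y))) / ((1 + y)\<^sup>2 * (1 + y)\<^sup>2) = 2 * (1 - y) / (1 + y) ^ 3"
      using y by (simp add: divide_simps) algebra
    finally show "((\<lambda>x. 2 * x / (1 + x)\<^sup>2 - h x) has_real_derivative 2 * (1 - y) / (1 + y) ^ 3 - E y) (at y)"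
      by (intro DERIV_diff dchi y)
    assume "2 * y / (1 + y)\<^sup>2 - h y < 0"
    then have "2 * y / (1 + y)\<^sup>2 * C y \<le> h y * C y"
      using C[OF y] by (intro mult_right_mono) auto
    \<comment> \<open>Without the factor \<open>y / (1 + y)\<^sup>2\<close> both sides are affine in
      \<open>m\<close>. The left side is at most \<open>2 * (m - 2) * (1 + y) + 5\<close>; the right
      side equals \<open>2 * (m - 2) * (1 + y) + 6 - 4 * q * (1 - y)\<close>.\<close>
    moreover have "y * ((1 - p y) * (m + p y)) \<le> 2 * y / (1 + y)\<^sup>2 * C y"
    proof -
      define q where "q = p y"
      have q: "y / 2 \<le> q" "q \<le> 1 / 2" "q \<le> y"
        using half[OF y] lower[OF y] by (auto simp: q_def)
      have "(1 - q) * (1 + y) \<le> (1 - y / 2) * (1 + y)"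
        using q y by (intro mult_right_mono) auto
      also have "\<dots> \<le> 2"
        using y by (simp add: field_simps) (smt (verit) mult_nonneg_nonneg)
      finally have "(m - 2) * (1 + y) * ((1 - q) * (1 + y)) \<le> (m - 2) * (1 + y) * 2"
        using m y by (intro mult_left_mono) auto
      moreover have "(1 - q) * (2 + q) * (1 + y)\<^sup>2 \<le> 5"
      proof -
        have "(1 - q) * (2 + q) \<le> (1 - y / 2) * (2 + y / 2)"
        proof -
          have "0 \<le> (q - y / 2) * (1 + q + y / 2)"
            using q y by simp
          then show ?thesis by (simp add: algebra_simps)
        qed
        then have "(1 - q) * (2 + q) * (1 + y)\<^sup>2 \<le> (1 - y / 2) * (2 + y / 2) * (1 + y)\<^sup>2"
          by (rule mult_right_mono) simp
        also have "\<dots> \<le> 5"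
        proof -
          have "y\<^sup>2 \<le> 1" "y ^ 3 \<le> 1"
            using y by (auto intro: power_le_one)
          \<comment> \<open>Equality holds at \<open>y = 1\<close>, so \<open>1 - y\<close> splits
            off; the product is four times the difference.\<close>
          then have "0 \<le> (1 - y) * (12 - 2 * y - 5 * y\<^sup>2 - y ^ 3)"
            using y by (intro mult_nonneg_nonneg) linarith+
          then show ?thesis
            by (simp add: power2_eq_square power3_eq_cube algebra_simps)
        qed
        finally show ?thesis .
      qed
      moreover have "4 * q * (1 - y) \<le> 1"
      proof -
        have "4 * q * (1 - y) \<le> 4 * y * (1 - y)"
          using q y by (intro mult_right_mono) auto
        also have "\<dots> \<le> 1"
          using zero_le_power2[of "2 * y - 1"] by (simp add: power2_eq_square algebra_simps)
        finally show ?thesis .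
      qed
      ultimately have "(1 - q) * (m + q) * (1 + y)\<^sup>2 \<le> 2 * (m + 1 + (m - 2) * y - 2 * q * (1 - y))"
        by (simp add: power2_eq_square algebra_simps)
      then have "(1 - q) * (m + q) \<le> 2 * C y / (1 + y)\<^sup>2"
        using y by (simp add: C_def q_def pos_le_divide_eq)
      then have "y * ((1 - q) * (m + q)) \<le> y * (2 * C y / (1 + y)\<^sup>2)"
        using y by (intro mult_left_mono) auto
      then show ?thesis
        by (simp add: q_def mult_ac)
    qed
    ultimately have "E y \<le> 0"
      using y by (simp add: E_def divide_nonpos_pos)
    moreover have "0 \<le> 2 * (1 - y) / (1 + y) ^ 3"
      using y by simp
    ultimately show "0 \<le> 2 * (1 - y) / (1 + y) ^ 3 - E y"
      by simp
  next
    show "((\<lambda>x. 2 * x / (1 + x)\<^sup>2 - h x) \<longlongrightarrow> 0) (at_right 0)"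
      by (auto intro!: tendsto_eq_intros lim)
  qed
  then show "h x \<le> 2 * x / (1 + x)\<^sup>2"
    by simp
qed

section \<open>The logarithmic derivative\<close>

text \<open>On \<open>(0, 1)\<close> this is the logarithmic derivative \<open>x g'(x) / g(x)\<close> of \<open>g x = green_poly m 1 x\<close>,
  with \<open>g'\<close> eliminated through \<open>(1 - x) g' = x\<^sup>m - (2m + 1) g\<close>; at \<open>x = 1\<close> it is junk.\<close>

definition green_elasticity :: "nat \<Rightarrow> real \<Rightarrow> real" where
  "green_elasticity m x = (x ^ (m + 1) / green_poly m 1 x - of_nat (2 * m + 1) * x) / (1 - x)"

text \<open>The shift \<open>m + 1\<close> is the limit of the elasticity at \<open>0\<close>, so
  \<psi> starts from \<open>0\<close>.\<close>

definition green_psi :: "nat \<Rightarrow> real \<Rightarrow> real" where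
  "green_psi m x = of_nat m + 1 - green_elasticity m x"

lemma green_psi_eq:
  "green_psi m x =
     of_nat m + 1 - (x ^ (m + 1) / green_poly m 1 x - of_nat (2 * m + 1) * x) / (1 - x)"
  by (simp add: green_psi_def green_elasticity_def)

section \<open>The linear equation for g and rational barriers for it\<close>

lemma DERIV_green_poly_one:
  assumes "x < 1"
  shows "(green_poly m 1 has_real_derivative
    (x ^ m - of_nat (2 * m + 1) * green_poly m 1 x) / (1 - x)) (at x)"
  using DERIV_green_poly_snd[of x 1 m] assms by simp

lemma tendsto_green_poly_one: "(green_poly m 1 \<longlongrightarrow> 0) (at_right 0)"
proof -
  have "isCont (green_poly m 1) 0"
    by (rule DERIV_isCont[OF DERIV_green_poly_one]) simp
  then show ?thesis
    by (simp add: isCont_def filterlim_at_split)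
qed

text \<open>The two bounds on \<open>g\<close> are the bounds \<open>x / 2 \<le> \<psi> x \<le> x / (1 + x)\<close> on \<open>\<psi> = green_psi m\<close>,
  solved for \<open>g\<close>: the equation for \<open>g\<close> is linear and regular at \<open>0\<close>.\<close>

lemma green_poly_one_le:
  fixes m :: nat and x :: real
  assumes x: "0 < x" "x < 1"
  shows "(of_nat m + 1 + 2 * of_nat m * x + (of_nat m + 1) * x\<^sup>2) * green_poly m 1 x \<le> x ^ (m + 1) * (1 + x)"
proof -
  define M where "M = (of_nat m :: real)"
  define Q where "Q = (\<lambda>x. M + 1 + 2 * M * x + (M + 1) * x\<^sup>2)"
  define w' where "w' = (\<lambda>x. (Q x - (1 + x) * (2 * M + 2 * (M + 1) * x)) / (Q x)\<^sup>2)"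
  \<comment> \<open>The value g would have if \<psi> were equal to
    \<open>x / (1 + x)\<close>.\<close>
  define U where "U = (\<lambda>x. x ^ (m + 1) * ((1 + x) / Q x))"
  have M: "0 \<le> M" by (simp add: M_def)
  have Q: "0 < Q y" if "0 \<le> y" for y
  proof -
    have "0 \<le> M * y" "0 \<le> (M + 1) * y\<^sup>2"
      using M that by simp_all
    then show ?thesis
      unfolding Q_def using M by linarith
  qed
  have "0 \<le> U x - green_poly m 1 x"
  proof (rule nonneg_barrier[OF _ _ _ x])
    fix y :: real assume y: "0 < y" "y < 1"
    define U' where "U' = y ^ m * ((M + 1) * ((1 + y) / Q y) + y * w' y)"
    have "((\<lambda>x. (1 + x) / Q x) has_real_derivative w' y) (at y)"
      using Q[of y] y unfolding Q_def w'_def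
      by (auto intro!: derivative_eq_intros simp: power2_eq_square)
    from DERIV_mult[OF DERIV_pow[of "m + 1"] this] have "(U has_real_derivative U') (at y)"
      unfolding U_def U'_def by (simp add: M_def algebra_simps add_divide_distrib)
    then show "((\<lambda>x. U x - green_poly m 1 x) has_real_derivative
        U' - (y ^ m - of_nat (2 * m + 1) * green_poly m 1 y) / (1 - y)) (at y)"
      by (intro DERIV_diff DERIV_green_poly_one y)
    assume "U y - green_poly m 1 y < 0"
    then have "(2 * M + 1) * U y \<le> (2 * M + 1) * green_poly m 1 y"
      using M by (intro mult_left_mono) auto
    \<comment> \<open>\<open>U\<close> is a supersolution of
      \<open>(1 - x) g' + (2 m + 1) g = x ^ m\<close>; the defect, up to \<open>y ^ m\<close>, is
      the explicit quotient computed below.\<close>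
    moreover have "y ^ m \<le> (1 - y) * U' + (2 * M + 1) * U y"
    proof -
      have "1 \<le> (1 - y) * ((M + 1) * ((1 + y) / Q y) + y * w' y) + (2 * M + 1) * y * ((1 + y) / Q y)"
      proof -
        have "((1 - y) * ((M + 1) * ((1 + y) / Q y) + y * w' y) + (2 * M + 1) * y * ((1 + y) / Q y)) - 1
          = 2 * y * (1 - y) ^ 2 / (Q y)\<^sup>2"
          unfolding w'_def using Q[of y] y
          by (simp add: divide_simps, simp add: Q_def, algebra)
        also have "0 \<le> \<dots>" using y by simp
        finally show ?thesis by simp
      qed
      from mult_left_mono[OF this, of "y ^ m"] show ?thesis
        using y by (simp add: U_def U'_def algebra_simps add_divide_distrib diff_divide_distrib)
    qed
    ultimately have "y ^ m - (2 * M + 1) * green_poly m 1 y \<le> U' * (1 - y)"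
      by (simp add: mult.commute)
    then show "0 \<le> U' - (y ^ m - of_nat (2 * m + 1) * green_poly m 1 y) / (1 - y)"
      using y by (simp add: M_def pos_divide_le_eq add.commute)
  next
    have "(U \<longlongrightarrow> 0) (at_right 0)"
      unfolding U_def Q_def using M by (auto intro!: tendsto_eq_intros)
    then show "((\<lambda>x. U x - green_poly m 1 x) \<longlongrightarrow> 0) (at_right 0)"
      using tendsto_diff[OF _ tendsto_green_poly_one, of U 0] by simp
  qed
  then have "Q x * green_poly m 1 x \<le> Q x * U x"
    using Q[of x] x by (intro mult_left_mono) auto
  then show ?thesis
    using Q[of x] x by (simp add: U_def Q_def M_def)
qed

lemma green_poly_one_ge:
  fixes m :: nat and x :: real
  assumes m: "2 \<le> m" and x: "0 < x" "x < 1"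
  shows "2 * x ^ (m + 1) \<le> (2 * of_nat m + 2 + (2 * of_nat m - 1) * x + x\<^sup>2) * green_poly m 1 x"
proof -
  define M where "M = (of_nat m :: real)"
  define Q where "Q = (\<lambda>x. 2 * M + 2 + (2 * M - 1) * x + x\<^sup>2)"
  define w' where "w' = (\<lambda>x. - (2 * (2 * M - 1 + 2 * x)) / (Q x)\<^sup>2)"
  define U where "U = (\<lambda>x. x ^ (m + 1) * (2 / Q x))"
  have M: "2 \<le> M" using m by (simp add: M_def)
  have Q: "0 < Q y" if "0 \<le> y" for y
    unfolding Q_def using M that by (intro add_pos_nonneg) auto
  have "0 \<le> green_poly m 1 x - U x"
  proof (rule nonneg_barrier[OF _ _ _ x])
    fix y :: real assume y: "0 < y" "y < 1"
    define U' where "U' = y ^ m * ((M + 1) * (2 / Q y) + y * w' y)"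
    have "((\<lambda>x. 2 / Q x) has_real_derivative w' y) (at y)"
      using Q[of y] y unfolding Q_def w'_def
      by (auto intro!: derivative_eq_intros simp: power2_eq_square)
    from DERIV_mult[OF DERIV_pow[of "m + 1"] this] have "(U has_real_derivative U') (at y)"
      unfolding U_def U'_def by (simp add: M_def algebra_simps add_divide_distrib)
    then show "((\<lambda>x. green_poly m 1 x - U x) has_real_derivative
        (y ^ m - of_nat (2 * m + 1) * green_poly m 1 y) / (1 - y) - U') (at y)"
      by (intro DERIV_diff DERIV_green_poly_one y)
    assume "green_poly m 1 y - U y < 0"
    then have "(2 * M + 1) * green_poly m 1 y \<le> (2 * M + 1) * U y"
      using M by (intro mult_left_mono) auto
    \<comment> \<open>Here \<open>U\<close> is a subsolution. The sign of the defect depends on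
      \<open>2 * M - 4 + y\<close>, which is where \<open>2 \<le> m\<close> enters; for
      \<open>m = 1\<close> this factor is negative.\<close>
    moreover have "(1 - y) * U' + (2 * M + 1) * U y \<le> y ^ m"
    proof -
      have "(1 - y) * ((M + 1) * (2 / Q y) + y * w' y) + (2 * M + 1) * y * (2 / Q y) \<le> 1"
      proof -
        have "1 - ((1 - y) * ((M + 1) * (2 / Q y) + y * w' y) + (2 * M + 1) * y * (2 / Q y))
          = y * (1 - y)\<^sup>2 * (2 * M - 4 + y) / (Q y)\<^sup>2"
          unfolding w'_def using Q[of y] y
          by (simp add: divide_simps, simp add: Q_def, algebra)
        also have "0 \<le> \<dots>" using y M by simp
        finally show ?thesis by simp
      qed
      from mult_left_mono[OF this, of "y ^ m"] show ?thesis
        using y by (simp add: U_def U'_def algebra_simps add_divide_distrib diff_divide_distrib)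
    qed
    ultimately have "U' * (1 - y) \<le> y ^ m - (2 * M + 1) * green_poly m 1 y"
      by (simp add: mult.commute)
    then show "0 \<le> (y ^ m - of_nat (2 * m + 1) * green_poly m 1 y) / (1 - y) - U'"
      using y by (simp add: M_def pos_le_divide_eq add.commute)
  next
    have "(U \<longlongrightarrow> 0) (at_right 0)"
      unfolding U_def Q_def using M by (auto intro!: tendsto_eq_intros)
    then show "((\<lambda>x. green_poly m 1 x - U x) \<longlongrightarrow> 0) (at_right 0)"
      using tendsto_diff[OF tendsto_green_poly_one, of U 0] by simp
  qed
  then have "Q x * U x \<le> Q x * green_poly m 1 x"
    using Q[of x] x by (intro mult_left_mono) auto
  then show ?thesis
    using Q[of x] x by (simp add: U_def Q_def M_def mult_ac)
qed

section \<open>Bounds, Riccati equation and increments of \<psi>\<close>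

lemma green_psi_le:
  assumes x: "0 < x" "x < 1"
  shows "green_psi m x \<le> x / (1 + x)"
proof -
  define M where "M = (of_nat m :: real)"
  define g where "g = green_poly m 1 x"
  have g: "0 < g" using x by (simp add: g_def green_poly_pos)
  have "(M + 1 - x / (1 + x)) * (1 - x) + (2 * M + 1) * x = (M + 1 + 2 * M * x + (M + 1) * x\<^sup>2) / (1 + x)"
    using x by (simp add: field_simps power2_eq_square)
  also have "\<dots> \<le> x ^ (m + 1) / g"
    using green_poly_one_le[OF x, of m] x g by (simp add: divide_simps g_def M_def mult_ac)
  finally have "(M + 1 - x / (1 + x)) * (1 - x) \<le> x ^ (m + 1) / g - (2 * M + 1) * x"
    by simp
  then have "M + 1 - x / (1 + x) \<le> (x ^ (m + 1) / g - (2 * M + 1) * x) / (1 - x)"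
    using x by (subst pos_le_divide_eq) auto
  moreover have "green_psi m x = M + 1 - (x ^ (m + 1) / g - (2 * M + 1) * x) / (1 - x)"
    by (simp add: green_psi_eq g_def M_def)
  ultimately show ?thesis
    by linarith
qed

lemma green_psi_ge:
  assumes m: "2 \<le> m" and x: "0 < x" "x < 1"
  shows "x / 2 \<le> green_psi m x"
proof -
  define M where "M = (of_nat m :: real)"
  define g where "g = green_poly m 1 x"
  have g: "0 < g" using x by (simp add: g_def green_poly_pos)
  have "x ^ (m + 1) / g \<le> (2 * M + 2 + (2 * M - 1) * x + x\<^sup>2) / 2"
    using green_poly_one_ge[OF m x] x g by (simp add: divide_simps g_def M_def mult_ac)
  also have "\<dots> = (M + 1 - x / 2) * (1 - x) + (2 * M + 1) * x"
    by (simp add: field_simps power2_eq_square)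
  finally have "x ^ (m + 1) / g - (2 * M + 1) * x \<le> (M + 1 - x / 2) * (1 - x)"
    by simp
  then have "(x ^ (m + 1) / g - (2 * M + 1) * x) / (1 - x) \<le> M + 1 - x / 2"
    using x by (subst pos_divide_le_eq) auto
  moreover have "green_psi m x = M + 1 - (x ^ (m + 1) / g - (2 * M + 1) * x) / (1 - x)"
    by (simp add: green_psi_eq g_def M_def)
  ultimately show ?thesis
    by linarith
qed

text \<open>The Riccati equation, in the form \<open>h x / x\<close> expected by
  \<open>riccati_bounds\<close>. The linear equation for g makes the derivative rational in
  \<open>x\<close> and \<open>e = x ^ m / g\<close>, and \<psi> is affine in
  \<open>e\<close>.\<close>

lemma DERIV_green_psi:
  fixes m :: nat and x :: real
  defines "p \<equiv> green_psi m x"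
  assumes x: "0 < x" "x < 1"
  shows "(green_psi m has_real_derivative
    (x * (1 - p) * (of_nat m + p) - p * (of_nat m + 1 - p)) / (1 - x) / x) (at x)"
proof -
  define M where "M = (of_nat m :: real)"
  define e where "e = x ^ m / green_poly m 1 x"
  have g: "0 < green_poly m 1 x" using x by (simp add: green_poly_pos)
  have "((\<lambda>x. x ^ (m + 1) / green_poly m 1 x) has_real_derivative
      ((M + 1) * x ^ m * green_poly m 1 x - x ^ (m + 1) * ((x ^ m - (2 * M + 1) * green_poly m 1 x) / (1 - x)))
        / (green_poly m 1 x * green_poly m 1 x)) (at x)"
    using DERIV_divide[OF DERIV_pow[of "m + 1"] DERIV_green_poly_one[OF x(2), of m]] g
    by (simp add: M_def add_ac)
  also have "((M + 1) * x ^ m * green_poly m 1 x - x ^ (m + 1) * ((x ^ m - (2 * M + 1) * green_poly m 1 x) / (1 - x)))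
        / (green_poly m 1 x * green_poly m 1 x) = (M + 1) * e - x * e * ((e - (2 * M + 1)) / (1 - x))"
    using g x by (simp add: e_def field_simps)
  finally have d: "((\<lambda>x. x ^ (m + 1) / green_poly m 1 x) has_real_derivative
      (M + 1) * e - x * e * ((e - (2 * M + 1)) / (1 - x))) (at x)" .
  have p: "p = M + 1 - x * (e - (2 * M + 1)) / (1 - x)"
    by (simp add: p_def green_psi_eq e_def M_def algebra_simps)
  have "((\<lambda>x. M + 1 - (q x - (2 * M + 1) * x) / (1 - x)) has_real_derivative
      - (((D - (2 * M + 1)) * (1 - x) + (q x - (2 * M + 1) * x)) / (1 - x)\<^sup>2)) (at x)"
    if "(q has_real_derivative D) (at x)" for q D
    using DERIV_diff[OF DERIV_const DERIV_divide[OF DERIV_diff[OF that DERIV_cmult[OF DERIV_ident]]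
        DERIV_diff[OF DERIV_const DERIV_ident]], of 1 "M + 1" "2 * M + 1"] x
    by (simp add: power2_eq_square diff_diff_eq2 add_diff_eq)
  from this[OF d] have "(green_psi m has_real_derivative
      - ((((M + 1) * e - x * e * ((e - (2 * M + 1)) / (1 - x)) - (2 * M + 1)) * (1 - x)
        + (x ^ (m + 1) / green_poly m 1 x - (2 * M + 1) * x)) / (1 - x)\<^sup>2)) (at x)"
    by (simp add: green_psi_eq[abs_def] M_def add.commute)
  also have "x ^ (m + 1) / green_poly m 1 x - (2 * M + 1) * x = x * (e - (2 * M + 1))"
    by (simp add: e_def right_diff_distrib)
  also have "- ((((M + 1) * e - x * e * ((e - (2 * M + 1)) / (1 - x)) - (2 * M + 1)) * (1 - x)
        + x * (e - (2 * M + 1))) / (1 - x)\<^sup>2) = (x * (1 - p) * (M + p) - p * (M + 1 - p)) / (1 - x) / x"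
    using x unfolding p by (simp add: divide_simps) algebra
  finally show ?thesis
    by (simp add: M_def)
qed

text \<open>For \<open>m = 0\<close> and \<open>m = 1\<close> the lower bound \<open>x / 2\<close>
  on \<psi> fails, so these cases are computed explicitly.\<close>

lemma green_psi_0: "0 < x \<Longrightarrow> x < 1 \<Longrightarrow> green_psi 0 x = 0"
  by (simp add: green_psi_eq green_poly_def)

lemma green_psi_1:
  assumes "0 < x" "x < 1"
  shows "green_psi (Suc 0) x = x / (3 - x)"
proof -
  have g: "green_poly (Suc 0) 1 x = x\<^sup>2 * (3 - x) / 6"
    by (simp add: green_poly_def power2_eq_square power3_eq_cube field_simps eval_nat_numeral)
  have "x ^ (Suc 0 + 1) / green_poly (Suc 0) 1 x = 6 / (3 - x)"
    using assms by (simp add: g power2_eq_square)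
  moreover have "6 / (3 - x) - 3 * x = 3 * (2 - x) / (3 - x) * (1 - x)"
    using assms by (simp add: divide_simps) algebra
  ultimately have "green_psi (Suc 0) x = 2 - 3 * (2 - x) / (3 - x)"
    using assms by (simp add: green_psi_eq)
  also have "\<dots> = x / (3 - x)"
    using assms by (simp add: divide_simps)
  finally show ?thesis .
qed

text \<open>For \<open>m \<ge> 2\<close> the bounds on \<psi>' are integrated from
  \<open>r * t\<close> to \<open>t\<close> and compared with the upper bound on \<psi> at
  \<open>r\<close>; for \<open>m = 1\<close> both sides are explicit.\<close>

lemma green_psi_increment:
  assumes m: "1 \<le> m" and t: "0 < t" "t < 1" and r: "0 < r" "r < 1"
  shows "0 \<le> green_psi m t - green_psi m (r * t)"
    and "green_psi m t - green_psi m (r * t) < 1 - 2 * green_psi m r"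
proof -
  have rt: "0 < r * t" "r * t < t" "r * t < 1"
    using t r mult_strict_mono[of r 1 t 1] by auto
  have "0 \<le> green_psi m t - green_psi m (r * t) \<and>
    green_psi m t - green_psi m (r * t) < 1 - 2 * green_psi m r"
  proof (cases "m = 1")
    case True
    have "green_psi (Suc 0) t - green_psi (Suc 0) (r * t) = 3 * t * (1 - r) / ((3 - t) * (3 - r * t))"
      using t rt by (simp add: green_psi_1 divide_simps) algebra
    moreover have "1 - 2 * green_psi (Suc 0) r = 3 * (1 - r) / (3 - r)"
      using r by (simp add: green_psi_1 divide_simps)
    moreover have "3 * t * (1 - r) / ((3 - t) * (3 - r * t)) < 3 * (1 - r) / (3 - r)"
    proof -
      have "t * (3 - r) < (3 - t) * (3 - r * t)"
      proof -
        have "(3 - t) * (3 - r * t) - t * (3 - r) = 6 * (1 - t) + (3 - 2 * (r * t)) + r * t * t"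
          by (simp add: algebra_simps)
        also have "\<dots> > 0"
          using t rt r by (intro add_pos_nonneg) auto
        finally show ?thesis by simp
      qed
      then have "3 * (1 - r) * (t * (3 - r)) < 3 * (1 - r) * ((3 - t) * (3 - r * t))"
        using r by (intro mult_strict_left_mono) auto
      then show ?thesis
        using t rt r by (simp add: divide_simps mult_ac)
    qed
    moreover have "0 \<le> 3 * t * (1 - r) / ((3 - t) * (3 - r * t))"
      using t r rt by simp
    ultimately show ?thesis
      using True by simp
  next
    case False
    then have m2: "2 \<le> m" using m by simp
    let ?c = "\<lambda>x. (x * (1 - green_psi m x) * (of_nat m + green_psi m x)
        - green_psi m x * (of_nat m + 1 - green_psi m x)) / (1 - x)"
    have c: "0 \<le> ?c x" "?c x \<le> 2 * x / (1 + x)\<^sup>2" if "0 < x" "x < 1" for x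
      using riccati_bounds[of "of_nat m" "green_psi m", OF _ DERIV_green_psi green_psi_ge[OF m2] green_psi_le that] m2
      by simp_all
    have "green_psi m (r * t) \<le> green_psi m t"
    proof (rule DERIV_nonneg_imp_nondecreasing[where f = "green_psi m"])
      fix x assume "r * t \<le> x" "x \<le> t"
      then have x: "0 < x" "x < 1" using rt t by auto
      show "\<exists>d. (green_psi m has_real_derivative d) (at x) \<and> 0 \<le> d"
        using DERIV_green_psi[OF x, of m] c(1)[OF x] x by (meson divide_nonneg_pos)
    qed (use rt in linarith)
    moreover have "green_psi m t - green_psi m (r * t) \<le> 2 / (1 + r * t) - 2 / (1 + t)"
    proof -
      have "green_psi m t + 2 / (1 + t) \<le> green_psi m (r * t) + 2 / (1 + r * t)"
      proof (rule DERIV_nonpos_imp_nonincreasing[where f = "\<lambda>x. green_psi m x + 2 / (1 + x)"])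
        fix x assume "r * t \<le> x" "x \<le> t"
        then have x: "0 < x" "x < 1" using rt t by auto
        have "((\<lambda>x. green_psi m x + 2 / (1 + x)) has_real_derivative ?c x / x - 2 / (1 + x)\<^sup>2) (at x)"
          using x by (auto intro!: derivative_eq_intros DERIV_green_psi simp: power2_eq_square)
        moreover have "?c x / x \<le> 2 / (1 + x)\<^sup>2"
          using x by (subst pos_divide_le_eq) (use c(2)[OF x] in simp_all)
        ultimately show "\<exists>d. ((\<lambda>x. green_psi m x + 2 / (1 + x)) has_real_derivative d) (at x) \<and> d \<le> 0"
          by (meson diff_le_0_iff_le)
      qed (use rt in linarith)
      then show ?thesis by simp
    qed
    moreover have "2 / (1 + r * t) - 2 / (1 + t) < 1 - 2 * (r / (1 + r))"
    proof -
      \<comment> \<open>Clearing denominators turns the difference of the two sides into exactly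
        this product.\<close>
      have "0 < (1 - r) * ((1 - t) * (1 - r * t))"
        using t r rt by simp
      also have "\<dots> = (1 - 2 * (r / (1 + r)) - (2 / (1 + r * t) - 2 / (1 + t))) * ((1 + r) * (1 + t) * (1 + r * t))"
        using t r rt by (simp add: divide_simps) algebra
      finally have "0 < 1 - 2 * (r / (1 + r)) - (2 / (1 + r * t) - 2 / (1 + t))"
        by (rule zero_less_mult_pos2) (use t r rt in simp)
      then show ?thesis
        by simp
    qed
    moreover have "1 - 2 * (r / (1 + r)) \<le> 1 - 2 * green_psi m r"
      using green_psi_le[OF r, of m] by simp
    ultimately show ?thesis
      by linarith
  qed
  then show "0 \<le> green_psi m t - green_psi m (r * t)"
    and "green_psi m t - green_psi m (r * t) < 1 - 2 * green_psi m r"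
    by auto
qed

section \<open>Critical points\<close>

lemma green_elasticity_eq: "green_elasticity m x = of_nat m + 1 - green_psi m x"
  by (simp add: green_psi_def)

lemma green_elasticity_less:
  assumes t: "0 < t" "t < 1" and r: "0 < r" "r < 1"
  shows "green_elasticity m (r * t) * (of_nat (2 * m + 1) - green_elasticity m r)
    < green_elasticity m r * green_elasticity m t"
proof (cases "m = 0")
  case True
  have "r * t < 1"
    using t r mult_strict_mono[of r 1 t 1] by auto
  then show ?thesis
    using True t r by (simp add: green_elasticity_eq green_psi_0)
next
  case False
  define M where "M = (of_nat m :: real)"
  define a b c where "a = green_psi m t" and "b = green_psi m (r * t)" and "c = green_psi m r"
  have rt: "0 < r * t" "r * t < 1"
    using t r mult_strict_mono[of r 1 t 1] by auto
  have m: "1 \<le> m" using False by simp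
  have ab: "0 \<le> a - b" "a - b < 1 - 2 * c"
    using green_psi_increment[OF m t r] by (simp_all add: a_def b_def c_def)
  \<comment> \<open>The increment lemma with \<open>r\<close> and \<open>t\<close> exchanged, since
    \<open>b\<close> is symmetric in them.\<close>
  have bc: "b \<le> c"
    using green_psi_increment(1)[OF m r t] by (simp add: b_def c_def mult.commute)
  have "r / (1 + r) < 1"
    using r by simp
  then have c: "c < M + 1"
    using green_psi_le[OF r, of m] by (simp add: c_def M_def)
  \<comment> \<open>In terms of \<open>a\<close>, \<open>b\<close>, \<open>c\<close> the claim reads
    \<open>(a - b) * (M + 1 - c) < (1 - 2 * c) * (M + 1 - b)\<close>; \<open>b \<le> c\<close> makes
    the factors comparable.\<close>
  have "(a - b) * (M + 1 - c) \<le> (a - b) * (M + 1 - b)"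
    using ab bc by (intro mult_left_mono) auto
  also have "\<dots> < (1 - 2 * c) * (M + 1 - b)"
    using ab bc c by (intro mult_strict_right_mono) auto
  finally have "(M + 1 - b) * (2 * M + 1 - (M + 1 - c)) < (M + 1 - c) * (M + 1 - a)"
    by (simp add: algebra_simps)
  then show ?thesis
    by (simp add: green_elasticity_eq a_def b_def c_def M_def add.commute)
qed

text \<open>By homogeneity \<open>H(t,s) = t ^ (2 m + 1) * g(s / t)\<close>. The definition of the
  elasticity expresses \<open>r ^ (m + 1)\<close> through \<open>a\<close> and \<open>g\<close>,
  which is inserted into both partial derivatives.\<close>

lemma
  assumes "0 < s" "s < t"
  shows DERIV_green_poly_snd_elasticity:
    "(green_poly m t has_real_derivative green_elasticity m (s / t) * green_poly m t s / s) (at s)"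
    and DERIV_green_poly_fst_elasticity:
    "((\<lambda>t. green_poly m t s) has_real_derivative
      (of_nat (2 * m + 1) - green_elasticity m (s / t)) * green_poly m t s / t) (at t)"
proof -
  define r N g T a where "r = s / t" and "N = (of_nat (2 * m + 1) :: real)" and "g = green_poly m 1 r"
    and "T = t ^ (2 * m + 1)" and "a = green_elasticity m r"
  have t: "0 < t" and r: "0 < r" "r < 1" and s: "s = t * r"
    using assms by (auto simp: r_def)
  have g: "0 < g"
    using r by (simp add: g_def green_poly_pos)
  have H: "green_poly m t s = T * g"
    using green_poly_scale[of m t 1 r] by (simp add: g_def s T_def)
  have "a * (1 - r) = r ^ (m + 1) / g - N * r"
    using r by (simp add: a_def green_elasticity_def g_def N_def)
  then have e: "r ^ (m + 1) = (a * (1 - r) + N * r) * g"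
    using g by (simp add: field_simps)
  have "t ^ (m + 1) * s ^ m = T * r ^ m"
    by (simp add: s T_def power_mult_distrib mult_2 power_add)
  also have "r ^ m = r ^ (m + 1) / r"
    using r by simp
  finally have 1: "t ^ (m + 1) * s ^ m = T * ((a * (1 - r) + N * r) * g / r)"
    unfolding e .
  have "s ^ (m + 1) * t ^ m = T * r ^ (m + 1)"
    by (simp add: s T_def power_mult_distrib mult_2 power_add)
  then have 2: "s ^ (m + 1) * t ^ m = T * ((a * (1 - r) + N * r) * g)"
    unfolding e .
  have "(T * ((a * (1 - r) + N * r) * g / r) - N * (T * g)) / (t - s) = a * (T * g) / s"
  proof -
    have "T * ((a * (1 - r) + N * r) * g / r) - N * (T * g) = a * (T * g) * (1 - r) / r"
      using r by (simp add: field_simps)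
    moreover have "t - s = t * (1 - r)"
      by (simp add: s right_diff_distrib)
    ultimately show ?thesis
      using r t by (simp add: s)
  qed
  then show "(green_poly m t has_real_derivative green_elasticity m (s / t) * green_poly m t s / s) (at s)"
    using DERIV_green_poly_snd[of s t m] assms
    unfolding H 1 N_def[symmetric] r_def[symmetric] a_def[symmetric] by simp
  have "(N * (T * g) - T * ((a * (1 - r) + N * r) * g)) / (t - s) = (N - a) * (T * g) / t"
  proof -
    have "N * (T * g) - T * ((a * (1 - r) + N * r) * g) = (N - a) * (T * g) * (1 - r)"
      by (simp add: algebra_simps)
    moreover have "t - s = t * (1 - r)"
      by (simp add: s right_diff_distrib)
    ultimately show ?thesis
      using r t by simp
  qed
  then show "((\<lambda>t. green_poly m t s) has_real_derivative
      (of_nat (2 * m + 1) - green_elasticity m (s / t)) * green_poly m t s / t) (at t)"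
    using DERIV_green_poly_fst[of s t m] assms
    unfolding H 2 N_def[symmetric] r_def[symmetric] a_def[symmetric] by simp
qed

text \<open>The constant factor \<open>c\<close> leaves the logarithmic derivative unchanged and the
  square root halves it.\<close>

lemma DERIV_sqrt_elasticity:
  fixes f :: "real \<Rightarrow> real"
  assumes "(f has_real_derivative \<beta> * f x / x) (at x)" "0 < f x" "0 < c"
  shows "((\<lambda>x. sqrt (f x * c)) has_real_derivative \<beta> * sqrt (f x * c) / (2 * x)) (at x)"
proof -
  have pos: "0 < f x * c"
    using assms by simp
  have "((\<lambda>x. sqrt (f x * c)) has_real_derivative
      inverse (sqrt (f x * c)) / 2 * (\<beta> * f x / x * c)) (at x)"
    using DERIV_real_sqrt[OF pos] DERIV_cmult_right[OF assms(1), of c]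
    by (rule DERIV_chain2[where f = sqrt and g = "\<lambda>x. f x * c" and x = x])
  also have "inverse (sqrt (f x * c)) / 2 * (\<beta> * f x / x * c)
      = \<beta> * ((f x * c) / sqrt (f x * c)) / (2 * x)"
  proof -
    have "inverse q / 2 * (\<beta> * u / x * c) = \<beta> * (u * c / q) / (2 * x)" for q u
      by (cases "x = 0"; cases "q = 0"; simp add: field_simps)
    then show ?thesis .
  qed
  also have "(f x * c) / sqrt (f x * c) = sqrt (f x * c)"
    using assms by (simp add: real_div_sqrt)
  finally show ?thesis .
qed

lemma no_offdiagonal_maximum:
  fixes m :: nat
  defines "\<Phi> \<equiv> \<lambda>t s. sqrt (green_poly m t s * green_poly m 1 1) - sqrt (green_poly m 1 t * green_poly m 1 s)"
  assumes st: "0 < s" "s < t" "t < 1"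
    and max: "\<And>t' s'. 0 < s' \<Longrightarrow> s' < t' \<Longrightarrow> t' < 1 \<Longrightarrow> \<Phi> t' s' \<le> \<Phi> t s"
  shows False
proof -
  define P where "P = sqrt (green_poly m t s * green_poly m 1 1)"
  define Q where "Q = sqrt (green_poly m 1 t * green_poly m 1 s)"
  let ?e = "green_elasticity m"
  have pos: "0 < green_poly m t s" "0 < green_poly m 1 1" "0 < green_poly m 1 t" "0 < green_poly m 1 s"
    using st by (auto intro: green_poly_pos)
  have PQ: "0 < P" "0 < Q"
    using pos by (simp_all add: P_def Q_def)
  have one: "(green_poly m 1 has_real_derivative ?e x * green_poly m 1 x / x) (at x)" if "0 < x" "x < 1" for x
    using DERIV_green_poly_snd_elasticity[OF that] by simp
  have cancel: "a = b" if "a / (2 * x) - b / (2 * x) = 0" "0 < x" for a b x :: real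
    using that by simp
  have "((\<lambda>t. \<Phi> t s) has_real_derivative
      (of_nat (2 * m + 1) - ?e (s / t)) * P / (2 * t) - ?e t * Q / (2 * t)) (at t)"
    unfolding \<Phi>_def P_def Q_def
    by (intro DERIV_diff DERIV_sqrt_elasticity DERIV_green_poly_fst_elasticity one) (use st pos in auto)
  \<comment> \<open>The radius keeps the moved point inside the open triangle where the maximality
    hypothesis applies.\<close>
  then have "(of_nat (2 * m + 1) - ?e (s / t)) * P / (2 * t) - ?e t * Q / (2 * t) = 0"
    by (rule DERIV_local_max[where d = "min (t - s) (1 - t)"]) (use st max in auto)
  then have 1: "(of_nat (2 * m + 1) - ?e (s / t)) * P = ?e t * Q"
    by (rule cancel) (use st in simp)
  have "(\<Phi> t has_real_derivative ?e (s / t) * P / (2 * s) - ?e s * Q / (2 * s)) (at s)"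
    unfolding \<Phi>_def P_def Q_def mult.commute[of "green_poly m 1 t"]
    by (intro DERIV_diff DERIV_sqrt_elasticity DERIV_green_poly_snd_elasticity one) (use st pos in auto)
  then have "?e (s / t) * P / (2 * s) - ?e s * Q / (2 * s) = 0"
    by (rule DERIV_local_max[where d = "min s (t - s)"]) (use st max in auto)
  then have 2: "?e (s / t) * P = ?e s * Q"
    by (rule cancel) (use st in simp)
  have "?e (s / t * t) * (of_nat (2 * m + 1) - ?e (s / t)) < ?e (s / t) * ?e t"
    by (rule green_elasticity_less) (use st in auto)
  \<comment> \<open>Multiplying by \<open>P * Q\<close> lets the critical point equations turn the
    right side into the left side, which contradicts strictness.\<close>
  then have "?e s * (of_nat (2 * m + 1) - ?e (s / t)) * (P * Q) < ?e (s / t) * ?e t * (P * Q)"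
    using PQ st by (intro mult_strict_right_mono) auto
  also have "\<dots> = (?e (s / t) * P) * (?e t * Q)"
    by (simp only: mult_ac)
  also have "\<dots> = ?e s * (of_nat (2 * m + 1) - ?e (s / t)) * (P * Q)"
    unfolding 1[symmetric] 2 by (simp only: mult_ac)
  finally show False
    by simp
qed

section \<open>Return to the Green function and the maximum over the square\<close>

lemma focal_green_eq:
  assumes "0 \<le> t" "0 \<le> s"
  shows "focal_green (Suc m) t s = green_poly m (max t s) (min t s) / (fact m)\<^sup>2"
proof (cases "s \<le> t")
  case True
  then show ?thesis
    using integral_eq_green_poly[of s t m] assms by (simp add: focal_green_def Let_def min_def max_def)
next
  case False
  then show ?thesis
    using integral_eq_green_poly[of t s m] assms
    by (simp add: focal_green_def Let_def min_def max_def mult.commute)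
qed

text \<open>Each radicand contains two values of the Green function, so each root contributes the
  same factor \<open>1 / (fact m)\<^sup>2\<close>, which does not affect where the maximum
  lies.\<close>

lemma focal_M_eq:
  assumes "t \<in> {0..1}" "s \<in> {0..1}"
  shows "focal_M (Suc m) t s =
    (sqrt (green_poly m (max t s) (min t s) * green_poly m 1 1) - sqrt (green_poly m 1 t * green_poly m 1 s))
      / (fact m)\<^sup>2"
proof -
  have 1: "max x 1 = 1" "min x 1 = x" if "x \<in> {0..1}" for x :: real
    using that by auto
  have 2: "0 \<le> t" "0 \<le> s"
    using assms by auto
  have *: "sqrt (a / c\<^sup>2 * (b / c\<^sup>2)) = sqrt (a * b) / c\<^sup>2" for a b c :: real
    by (simp add: real_sqrt_divide real_sqrt_mult power2_eq_square)
  show ?thesis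
    by (simp only: focal_M_def focal_green_eq 1[OF assms(1)] 1[OF assms(2)] max.idem min.idem zero_le_one 2 *
        flip: diff_divide_distrib)
qed

theorem theorem1:
  fixes k :: nat
  assumes "k \<ge> 1"
  shows "\<exists>t\<^sub>0\<in>{0..1}. \<forall>t\<in>{0..1}. \<forall>s\<in>{0..1}. focal_M k t s \<le> focal_M k t\<^sub>0 t\<^sub>0"
proof -
  obtain m where k: "k = Suc m"
    using assms by (cases k) auto
  define \<Phi> where "\<Phi> = (\<lambda>t s. sqrt (green_poly m (max t s) (min t s) * green_poly m 1 1)
    - sqrt (green_poly m 1 t * green_poly m 1 s))"
  have "\<exists>t\<^sub>0\<in>{0..1}. \<forall>t\<in>{0..1}. \<forall>s\<in>{0..1}. \<Phi> t s \<le> \<Phi> t\<^sub>0 t\<^sub>0"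
  proof -
    have sym: "\<Phi> t s = \<Phi> s t" for t s
      by (simp add: \<Phi>_def max.commute min.commute mult.commute)
    \<comment> \<open>At \<open>1\<close> the two radicands coincide, at \<open>0\<close> both
      vanish.\<close>
    have edge: "\<Phi> 1 s = 0" "\<Phi> 0 s = 0" if "s \<in> {0..1}" for s
      using that by (cases "s = 1"; simp add: \<Phi>_def max_def min_def mult.commute)+
    have "continuous_on ({0..1} \<times> {0..1}) (\<lambda>p. \<Phi> (fst p) (snd p))"
      unfolding \<Phi>_def by (intro continuous_intros)
    moreover have "compact ({0..1::real} \<times> {0..1::real})" "{0..1::real} \<times> {0..1::real} \<noteq> {}"
      by (auto intro: compact_Times)
    ultimately obtain p where p: "p \<in> {0..1} \<times> {0..1}"
      "\<forall>q\<in>{0..1} \<times> {0..1}. \<Phi> (fst q) (snd q) \<le> \<Phi> (fst p) (snd p)"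
      using continuous_attains_sup by meson
    \<comment> \<open>By symmetry the maximizer may be reflected into the triangle
      \<open>s \<le> t\<close>.\<close>
    define t s where "t = max (fst p) (snd p)" and "s = min (fst p) (snd p)"
    have st: "s \<in> {0..1}" "t \<in> {0..1}" "s \<le> t"
      using p(1) by (auto simp: s_def t_def)
    have "\<Phi> (fst p) (snd p) = \<Phi> t s"
      using sym by (simp add: s_def t_def max_def min_def)
    then have max: "\<Phi> t' s' \<le> \<Phi> t s" if "t' \<in> {0..1}" "s' \<in> {0..1}" for t' s'
      using p(2) that by force
    show ?thesis
    proof (cases "s = t \<or> s = 0 \<or> t = 1")
      case True
      \<comment> \<open>On the edges the maximal value is \<open>0\<close>, which the diagonal point
        \<open>(1, 1)\<close> attains as well.\<close>
      then have "\<Phi> t s = \<Phi> t t \<or> \<Phi> t s = \<Phi> 1 1"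
        using edge st sym by (metis atLeastAtMost_iff order_refl zero_le_one)
      then show ?thesis
        using max st by (metis atLeastAtMost_iff order_refl zero_le_one)
    next
      case False
      then have "0 < s" "s < t" "t < 1"
        using st by auto
      then have False
      proof (rule no_offdiagonal_maximum[of s t m])
        fix t' s' :: real assume "0 < s'" "s' < t'" "t' < 1"
        then show "sqrt (green_poly m t' s' * green_poly m 1 1) - sqrt (green_poly m 1 t' * green_poly m 1 s')
          \<le> sqrt (green_poly m t s * green_poly m 1 1) - sqrt (green_poly m 1 t * green_poly m 1 s)"
          using max[of t' s'] st by (simp add: \<Phi>_def max.absorb1 min.absorb2)
      qed
      then show ?thesis ..
    qed
  qed
  moreover have "focal_M k t s = \<Phi> t s / (fact m)\<^sup>2" if "t \<in> {0..1}" "s \<in> {0..1}" for t s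
    unfolding k \<Phi>_def by (rule focal_M_eq[OF that])
  moreover have "0 \<le> (fact m :: real)\<^sup>2"
    by simp
  ultimately show ?thesis
    by (metis divide_right_mono)
qed

end
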